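(* Let $(J,R,Q,B)\in\Sigma_{n,m}$ and $S\in\mathbb{K}^{m\times m}$ with $S=S^H\ge0$. Then the pencil $s\mathcal{E}-\mathcal{A}_S$ is regular if and only if there exists $\omega\in\mathbb{R}$ such that $$\dim\big(B\ker S+(JQ-i\omega I)\ker RQ\big)=m+n-(\operatorname{rk}S+\operatorname{rk}RQ).$$
   Context: $\mathbb{K}\in\{\mathbb{R},\mathbb{C}\}$, $n,m$ are positive integers, $A^H$ is the conjugate transpose, $\operatorname{rk}$ is the rank, and $A\ge0$ means $x^HAx\ge0$ for all $x$. $\Sigma_{n,m}$ is the set of all $(J,R,Q,B)\in(\mathbb{K}^{n\times n})^3\times\mathbb{K}^{n\times m}$ with $J=-J^H$, $R=R^H\ge0$, $Q=Q^H\ge0$. The optimality pencil $s\mathcal{E}-\mathcal{A}_S$ has coefficients $$\mathcal{E}=\begin{bmatrix}0_{n\times n}&I_n&0_{n\times m}\\-I_n&0_{n\times n}&0_{n\times m}\\0_{m\times n}&0_{m\times n}&0_{m\times m}\end{bmatrix},\qquad \mathcal{A}_S=\begin{bmatrix}0_{n\times n}&(J-R)Q&B\\((J-R)Q)^H&QRQ&0_{n\times m}\\ B^H&0_{m\times n}&S\end{bmatrix}.$$ It is called regular if $\det(s\mathcal{E}-\mathcal{A}_S)$ is not the zero polynomial in $s$. For a matrix $M$ and a subspace $W$, $MW$ denotes the image of $W$ under $M$. If $\mathbb{K}=\mathbb{R}$, kernels, images and dimensions in expressions involving $i\omega$ are taken over $\mathbb{C}$. *)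

theory Defs
  imports
    "HOL-Analysis.Analysis"
    "HOL-Computational_Algebra.Polynomial"
    "HOL-Library.Set_Algebras"
    "Jordan_Normal_Form.Conjugate"
begin

text \<open>
  A \<open>p \<times> q\<close> matrix over \<open>'a\<close> has type \<open>'a^'q^'p\<close>. The field \<open>\<K>\<close> is one of the types \<open>real\<close>,
  \<open>complex\<close>; on these, \<^const>\<open>conjugate\<close> is the identity and \<^const>\<open>cnj\<close>, respectively.
\<close>

definition conj_transpose :: "'a::conjugatable_field^'n^'m \<Rightarrow> 'a^'m^'n"
  where "conj_transpose A = (\<chi> i j. conjugate (A $ j $ i))"

text \<open>
  The vector \<open>x\<close> ranges over \<open>\<K>\<^sup>n\<close> only. For \<open>\<K> = \<complex>\<close> the order is that of
  \<^theory>\<open>HOL-Library.Complex_Order\<close>, so \<open>0 \<le> z\<close> means that \<open>z\<close> is real and nonnegative.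
\<close>

definition pos_semidef :: "'a::conjugatable_ordered_field^'n^'n \<Rightarrow> bool"
  where "pos_semidef A \<longleftrightarrow> (\<forall>x. 0 \<le> (\<Sum>i\<in>UNIV. conjugate (x $ i) * (A *v x) $ i))"

definition Sigma_systems ::
    "(('a::conjugatable_ordered_field^'n^'n) \<times> ('a^'n^'n) \<times> ('a^'n^'n) \<times> ('a^'m^'n)) set"
  where "Sigma_systems = {(J, R, Q, B).
    J = - conj_transpose J \<and>
    R = conj_transpose R \<and> pos_semidef R \<and>
    Q = conj_transpose Q \<and> pos_semidef Q}"

definition block3 ::
    "'a^'k^'k \<Rightarrow> 'a^'l^'k \<Rightarrow> 'a^'m^'k \<Rightarrow>
     'a^'k^'l \<Rightarrow> 'a^'l^'l \<Rightarrow> 'a^'m^'l \<Rightarrow>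
     'a^'k^'m \<Rightarrow> 'a^'l^'m \<Rightarrow> 'a^'m^'m \<Rightarrow> 'a^('k::finite + 'l::finite + 'm::finite)^('k + 'l + 'm)"
  where "block3 A11 A12 A13 A21 A22 A23 A31 A32 A33 = (\<chi> p q.
    (case p of
       Inl i \<Rightarrow>
         (case q of Inl j \<Rightarrow> A11 $ i $ j | Inr (Inl j) \<Rightarrow> A12 $ i $ j | Inr (Inr j) \<Rightarrow> A13 $ i $ j)
     | Inr (Inl i) \<Rightarrow>
         (case q of Inl j \<Rightarrow> A21 $ i $ j | Inr (Inl j) \<Rightarrow> A22 $ i $ j | Inr (Inr j) \<Rightarrow> A23 $ i $ j)
     | Inr (Inr i) \<Rightarrow>
         (case q of Inl j \<Rightarrow> A31 $ i $ j | Inr (Inl j) \<Rightarrow> A32 $ i $ j | Inr (Inr j) \<Rightarrow> A33 $ i $ j)))"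

definition opt_E :: "'a::field^('n::finite + 'n + 'm::finite)^('n + 'n + 'm)"
  where "opt_E = block3
    0           (mat 1)  0
    (- mat 1)   0        0
    0           0        0"

definition opt_A ::
    "'a::conjugatable_field^'n^'n \<Rightarrow> 'a^'n^'n \<Rightarrow> 'a^'n^'n \<Rightarrow> 'a^'m^'n \<Rightarrow> 'a^'m^'m \<Rightarrow>
     'a^('n::finite + 'n + 'm::finite)^('n + 'n + 'm)"
  where "opt_A J R Q B S = block3
    0                                ((J - R) ** Q)  B
    (conj_transpose ((J - R) ** Q))  (Q ** R ** Q)   0
    (conj_transpose B)               0               S"

text \<open>The pencil \<open>s E - A\<close> is a matrix of polynomials in the indeterminate \<open>s\<close>.\<close>

definition regular_pencil :: "'a::field^'k^'k \<Rightarrow> 'a^'k^'k \<Rightarrow> bool"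
  where "regular_pencil E A \<longleftrightarrow>
    det (map_matrix (\<lambda>e. [:0, e:]) E - map_matrix (\<lambda>a. [:a:]) A) \<noteq> 0"

definition mat_ker :: "'a::field^'n^'m \<Rightarrow> ('a^'n) set"
  where "mat_ker A = {x. A *v x = 0}"

text \<open>
  The subspace \<open>B ker S + (J Q - \<i> \<omega> I) ker (R Q)\<close> of \<open>\<complex>\<^sup>n\<close>; the outer addition is the Minkowski sum
  of sets. Real matrices have to be embedded into the complex ones first.
\<close>

definition ker_image_sum ::
    "complex^'n^'n \<Rightarrow> complex^'n^'n \<Rightarrow> complex^'n^'n \<Rightarrow> complex^'m^'n \<Rightarrow> complex^'m^'m \<Rightarrow>
     real \<Rightarrow> (complex^'n) set"
  where "ker_image_sum J R Q B S \<omega> =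
    (*v) B ` mat_ker S + (*v) (J ** Q - mat (\<i> * complex_of_real \<omega>)) ` mat_ker (R ** Q)"

abbreviation complexify :: "real^'n^'m \<Rightarrow> complex^'n^'m"
  where "complexify \<equiv> map_matrix complex_of_real"

end

theory Submission
  imports Defs
begin

text \<open>
  The determinant of the pencil is a polynomial, so it is nonzero if and only if it is nonzero at some
  point \<open>s = \<i>\<omega>\<close> of the imaginary axis (\<open>regular_pencil_iff_det_neq_0\<close>). The proof shows more than
  the equivalence of the two existence statements: at each single \<open>\<omega>\<close>, the matrix \<open>s \<E> - \<A>\<^sub>S\<close> is
  invertible if and only if the dimension formula holds at that \<open>\<omega>\<close>.

  By the rank-nullity theorem (\<open>vec_dim_mat_ker\<close>), the right-hand side of the formula is
  \<open>dim ker S + dim ker R Q\<close>. Hence the formula says that \<open>(u, y) \<mapsto> B u + (J Q - s) y\<close> is injective on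
  \<open>ker S \<times> ker R Q\<close> (\<open>vec_dim_sum_images_eq_iff\<close>).

  To compare this with the kernel of \<open>s \<E> - \<A>\<^sub>S\<close>, take a kernel vector \<open>(x, y, u)\<close>. On the imaginary
  axis the pencil has a Hermitian structure, and the semidefinite blocks \<open>Q R Q\<close> and \<open>S\<close> force
  \<open>R Q y = 0\<close> and \<open>S u = 0\<close>, so that \<open>(u, y)\<close> lies in the kernel of the map above
  (\<open>opt_pencil_nonsingular_iff\<close>). If that map is injective, only \<open>x\<close> is left, with
  \<open>Q (J + R) x = s x\<close>. The same injectivity also rules out \<open>x \<noteq> 0\<close> (\<open>costate_eq_0_if_injective\<close>), which is
  why no perturbation of \<open>\<omega>\<close> is necessary.

  The real case follows from the complex one, since complexification preserves regularity,
  semidefiniteness and rank.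
\<close>

section \<open>Dimensions of images and kernels\<close>

lemma vec_dim_image_eq_iff_inj:
  fixes A :: "'a::field^'n^'k"
  assumes V: "vec.subspace V"
  shows "vec.dim ((*v) A ` V) = vec.dim V \<longleftrightarrow> (\<forall>x\<in>V. A *v x = 0 \<longrightarrow> x = 0)"
proof
  have sp: "vec.span V = V" using V by simp
  assume "\<forall>x\<in>V. A *v x = 0 \<longrightarrow> x = 0"
  then have "inj_on ((*v) A) (vec.span V)"
    using V by (auto simp: inj_on_def sp) (metis matrix_vector_mult_diff_distrib right_minus_eq vec.subspace_diff)
  then show "vec.dim ((*v) A ` V) = vec.dim V"
    by (intro vec.dim_image_eq) auto
next
  assume eq: "vec.dim ((*v) A ` V) = vec.dim V"
  obtain B where B: "B \<subseteq> V" "vec.independent B" "V \<subseteq> vec.span B" "card B = vec.dim V"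
    using vec.basis_exists by blast
  have fin: "finite B" using B(2) by (rule vec.finiteI_independent)
  have spB: "vec.span B = V" using B V by (meson subset_antisym vec.span_minimal)
  have img: "(*v) A ` V = vec.span ((*v) A ` B)"
    using vec.span_image[of A B] spB by simp
  have ind: "vec.independent ((*v) A ` B)" 
    by (rule vec.card_le_dim_spanning[of _ "vec.span ((*v) A ` B)"])
       (use fin eq img B(4) card_image_le[OF fin, of "(*v) A"] in \<open>auto simp: vec.span_base\<close>)
  have "card ((*v) A ` B) = card B"
    using vec.dim_span_eq_card_independent[OF ind] eq img B(4) by simp
  then have "inj_on ((*v) A) B" using fin by (simp add: eq_card_imp_inj_on)
  then have "inj_on ((*v) A) (vec.span B)"
    using ind by (subst vec.inj_on_span_iff_independent_image) auto
  then show "\<forall>x\<in>V. A *v x = 0 \<longrightarrow> x = 0"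
    unfolding spB by (metis V inj_on_def matrix_vector_mult_0_right vec.subspace_0)
qed

text \<open>
  The dimension of \<open>A V + C W\<close> is bounded by \<open>dim V + dim W\<close>, and Grassmann's formula splits the deficit into
  three nonnegative parts: the loss under \<open>A\<close>, the loss under \<open>C\<close>, and the overlap of the two images.
  So equality turns a statement about dimensions into an injectivity statement, which is the form
  in which a kernel of the pencil can be compared with it.
\<close>

lemma vec_dim_sum_images_eq_iff:
  fixes A :: "'a::field^'m^'k" and C :: "'a^'n^'k"
  assumes V: "vec.subspace V" and W: "vec.subspace W"
  shows "vec.dim ((*v) A ` V + (*v) C ` W) = vec.dim V + vec.dim W \<longleftrightarrow>
         (\<forall>u\<in>V. \<forall>x\<in>W. A *v u + C *v x = 0 \<longrightarrow> u = 0 \<and> x = 0)" (is "?L \<longleftrightarrow> ?R")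
proof -
  let ?AV = "(*v) A ` V" and ?CW = "(*v) C ` W"
  have sub: "vec.subspace ?AV" "vec.subspace ?CW"
    using vec.subspace_image V W by auto
  have grassmann: "vec.dim (?AV + ?CW) + vec.dim (?AV \<inter> ?CW) = vec.dim ?AV + vec.dim ?CW"
  proof -
    have "?AV + ?CW = {x + y |x y. x \<in> ?AV \<and> y \<in> ?CW}" by (auto simp: set_plus_def)
    then show ?thesis using vec.dim_sums_Int[OF sub] by simp
  qed
  have le: "vec.dim ?AV \<le> vec.dim V" "vec.dim ?CW \<le> vec.dim W"
    using vec.dim_image_le by auto
  have int0: "vec.dim (?AV \<inter> ?CW) = 0 \<longleftrightarrow> ?AV \<inter> ?CW \<subseteq> {0}"
    by simp
  have "?L \<longleftrightarrow> vec.dim ?AV = vec.dim V \<and> vec.dim ?CW = vec.dim W \<and> vec.dim (?AV \<inter> ?CW) = 0"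
    using grassmann le by linarith
  also have "\<dots> \<longleftrightarrow> (\<forall>u\<in>V. A *v u = 0 \<longrightarrow> u = 0) \<and> (\<forall>x\<in>W. C *v x = 0 \<longrightarrow> x = 0) \<and> ?AV \<inter> ?CW \<subseteq> {0}"
    by (simp only: vec_dim_image_eq_iff_inj[OF V] vec_dim_image_eq_iff_inj[OF W] int0)
  also have "\<dots> \<longleftrightarrow> ?R"
  proof (intro iffI conjI ballI impI subsetI)
    fix u x assume h: "(\<forall>u\<in>V. A *v u = 0 \<longrightarrow> u = 0) \<and> (\<forall>x\<in>W. C *v x = 0 \<longrightarrow> x = 0) \<and> ?AV \<inter> ?CW \<subseteq> {0}"
      and ux: "u \<in> V" "x \<in> W" "A *v u + C *v x = 0"
    have "A *v u = C *v (- x)" using ux(3) by (metis add_eq_0_iff2 vec.neg)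
    moreover have "- x \<in> W" using W ux(2) by (simp add: vec.subspace_neg)
    ultimately have "A *v u = 0" using h ux(1) by blast
    with h ux show "u = 0" "x = 0" by auto
  next
    fix u assume ?R "u \<in> V" "A *v u = 0"
    then show "u = 0" using vec.subspace_0[OF W] by force
  next
    fix x assume ?R "x \<in> W" "C *v x = 0"
    then show "x = 0" using vec.subspace_0[OF V] by force
  next
    fix z assume R: ?R and "z \<in> ?AV \<inter> ?CW"
    then obtain u x where "u \<in> V" "x \<in> W" "z = A *v u" "z = C *v x" by auto
    moreover have "- x \<in> W" using W \<open>x \<in> W\<close> by (simp add: vec.subspace_neg)
    moreover have "A *v u + C *v (- x) = 0"
      using calculation by (simp add: vec.neg)
    ultimately have "u = 0" using R by blast
    then show "z \<in> {0}" using \<open>z = A *v u\<close> by simp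
  qed
  finally show ?thesis .
qed

lemma subspace_mat_ker: "vec.subspace (mat_ker A)"
  unfolding mat_ker_def
  by (auto simp: vec.subspace_def matrix_vector_right_distrib vec.scale)

lemma vec_dim_coordinate_subspace:
  "vec.dim {y::'a::field^'n. \<forall>i\<in>I. y $ i = 0} + card I = CARD('n)"
proof -
  let ?b = "(\<lambda>i. axis i 1) ` (- I) :: ('a^'n) set"
  have inj: "inj (\<lambda>i. axis i 1 :: 'a^'n)" by (auto simp: inj_on_def axis_eq_axis)
  have "vec.dim {y::'a^'n. \<forall>i\<in>I. y $ i = 0} = card (- I)"
  proof (rule vec.dim_unique[of ?b])
    show "?b \<subseteq> {y. \<forall>i\<in>I. y $ i = 0}" by (auto simp: axis_def)
    show "{y. \<forall>i\<in>I. y $ i = 0} \<subseteq> vec.span ?b"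
    proof
      fix y :: "'a^'n" assume y: "y \<in> {y. \<forall>i\<in>I. y $ i = 0}"
      have "y = (\<Sum>i\<in>UNIV. y $ i *s axis i 1)" by (simp add: basis_expansion)
      also have "\<dots> = (\<Sum>i\<in>- I. y $ i *s axis i 1)"
        using y by (intro sum.mono_neutral_right) auto
      also have "\<dots> \<in> vec.span ?b"
        by (intro vec.span_sum vec.span_scale vec.span_base) auto
      finally show "y \<in> vec.span ?b" .
    qed
    have "?b \<subseteq> cart_basis" by (auto simp: cart_basis_def)
    then show "vec.independent ?b" using independent_cart_basis vec.independent_mono by blast
    show "card ?b = card (- I)" using inj by (intro card_image) (auto simp: inj_on_def)
  qed
  then show ?thesis
    by (simp add: Compl_eq_Diff_UNIV card_Diff_subset card_mono)
qed

text \<open>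
  Here \<^const>\<open>rank\<close> is the row rank over an arbitrary field, so orthogonality cannot be used.
  Instead, a basis \<open>B\<close> of the row space is extended to a basis of the whole space, whose vectors
  become the rows of an invertible matrix \<open>P\<close>. In the coordinates \<open>P x\<close> the kernel is a coordinate
  subspace: the entries that belong to \<open>B\<close> vanish.
\<close>

lemma vec_dim_mat_ker:
  fixes A :: "'a::field^'n^'m"
  shows "vec.dim (mat_ker A) + rank A = CARD('n)"
proof -
  obtain B where B: "B \<subseteq> rows A" "vec.independent B" "rows A \<subseteq> vec.span B" "card B = vec.dim (rows A)"
    using vec.basis_exists by blast
  define D where "D = vec.extend_basis B"
  have D: "B \<subseteq> D" "vec.independent D" "vec.span D = UNIV"
    unfolding D_def using B(2) vec.extend_basis_superset vec.independent_extend_basis vec.span_extend_basis by auto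
  have finD: "finite D" using D(2) by (rule vec.finiteI_independent)
  have "card D = CARD('n)"
    using vec.dim_eq_card[OF _ D(2), of UNIV] D(3) by (metis vec.span_UNIV vec_dim_card)
  then obtain b :: "'n \<Rightarrow> 'a^'n" where b: "bij_betw b UNIV D"
    using finite_same_card_bij[of "UNIV :: 'n set" D] finD by auto
  define P where "P = (\<chi> i. b i)"
  have P: "(P *v x) $ i = (\<Sum>j\<in>UNIV. b i $ j * x $ j)" for x i
    by (simp add: P_def matrix_vector_mult_def)
  have "rows P = D" using b by (auto simp: rows_def row_def P_def bij_betw_def)
  then obtain P' where P': "P' ** P = mat 1"
    using D(3) matrix_left_invertible_span_rows_gen[of P] by auto
  then have PP': "P ** P' = mat 1" by (simp add: matrix_left_right_inverse)
  define I where "I = {i. b i \<in> B}"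
  have I: "b ` I = B" using b D(1) unfolding I_def bij_betw_def by blast
  have cardI: "card I = rank A"
    using card_image[of b I] I b B(4) by (auto simp: row_rank_def_gen bij_betw_def inj_on_def)
  have ann: "vec.subspace {r. (\<Sum>j\<in>UNIV. r $ j * x $ j) = 0}" for x :: "'a^'n"
    by (auto simp: vec.subspace_def algebra_simps sum.distrib sum_distrib_left[symmetric])
  have ker: "x \<in> mat_ker A \<longleftrightarrow> (\<forall>i\<in>I. (P *v x) $ i = 0)" for x
  proof -
    have "x \<in> mat_ker A \<longleftrightarrow> rows A \<subseteq> {r. (\<Sum>j\<in>UNIV. r $ j * x $ j) = 0}"
      by (auto simp: mat_ker_def vec_eq_iff matrix_vector_mult_def rows_def row_def)
    also have "\<dots> \<longleftrightarrow> B \<subseteq> {r. (\<Sum>j\<in>UNIV. r $ j * x $ j) = 0}"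
      using B(1,3) vec.span_minimal[OF _ ann, of B x] by blast
    also have "\<dots> \<longleftrightarrow> (\<forall>i\<in>I. (P *v x) $ i = 0)"
      unfolding I[symmetric] P by auto
    finally show ?thesis .
  qed
  have img: "(*v) P ` mat_ker A = {y. \<forall>i\<in>I. y $ i = 0}"
  proof (intro subset_antisym subsetI)
    fix y :: "'a^'n" assume "y \<in> {y. \<forall>i\<in>I. y $ i = 0}"
    then have "P *v (P' *v y) = y" "P' *v y \<in> mat_ker A"
      using ker[of "P' *v y"] by (auto simp: matrix_vector_mul_assoc PP')
    then show "y \<in> (*v) P ` mat_ker A" by (metis image_eqI)
  qed (use ker in auto)
  have "\<forall>x\<in>mat_ker A. P *v x = 0 \<longrightarrow> x = 0"
    using P' by (meson matrix_left_invertible_ker)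
  then have "vec.dim (mat_ker A) = vec.dim {y::'a^'n. \<forall>i\<in>I. y $ i = 0}"
    using vec_dim_image_eq_iff_inj[OF subspace_mat_ker, of P A] img by simp
  then show ?thesis using vec_dim_coordinate_subspace[of I] cardI by simp
qed

section \<open>Regularity as nonsingularity at a point\<close>

lemma det_map_matrix:
  fixes M :: "'a::comm_ring_1^'k^'k" and h :: "'a \<Rightarrow> 'b::comm_ring_1"
  assumes add: "\<And>x y. h (x + y) = h x + h y" and mult: "\<And>x y. h (x * y) = h x * h y" and one: "h 1 = 1"
  shows "det (map_matrix h M) = h (det M)"
proof -
  have zero: "h 0 = 0" using add[of 0 0] by simp
  have neg: "h (- x) = - h x" for x using add[of x "- x"] zero by (simp add: eq_neg_iff_add_eq_0 add.commute)
  have sum: "h (sum f X) = (\<Sum>x\<in>X. h (f x))" for f :: "'c \<Rightarrow> 'a" and X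
    by (induction X rule: infinite_finite_induct) (auto simp: zero add)
  have prod: "h (prod f X) = (\<Prod>x\<in>X. h (f x))" for f :: "'c \<Rightarrow> 'a" and X
    by (induction X rule: infinite_finite_induct) (auto simp: one mult)
  have sgn: "h (of_int (sign p)) = of_int (sign p)" for p :: "'k \<Rightarrow> 'k"
    by (simp add: sign_def one neg)
  show ?thesis by (simp add: det_def sum mult prod sgn)
qed

text \<open>
  A nonzero polynomial cannot vanish on an infinite set. The imaginary axis is the right set for the
  energy argument below, and the real axis is the right one for comparing a real pencil with its
  complexification.
\<close>

lemma regular_pencil_iff_det_neq_0:
  fixes E A :: "'a::field^'k^'k"
  assumes "infinite X"
  shows "regular_pencil E A \<longleftrightarrow> (\<exists>s\<in>X. det (map_matrix ((*) s) E - A) \<noteq> 0)"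
proof -
  define M where "M = map_matrix (\<lambda>e. [:0, e:]) E - map_matrix (\<lambda>a. [:a:]) A"
  have ev: "poly (det M) s = det (map_matrix ((*) s) E - A)" for s
  proof -
    have "map_matrix (\<lambda>p. poly p s) M = map_matrix ((*) s) E - A"
      by (simp add: M_def vec_eq_iff)
    then show ?thesis using det_map_matrix[of "\<lambda>p. poly p s" M] by simp
  qed
  have "det M \<noteq> 0 \<longleftrightarrow> (\<exists>s\<in>X. poly (det M) s \<noteq> 0)"
  proof
    assume "det M \<noteq> 0"
    then have "finite {s. poly (det M) s = 0}" by (rule poly_roots_finite)
    then show "\<exists>s\<in>X. poly (det M) s \<noteq> 0" using assms by (metis (mono_tags, lifting) finite_subset mem_Collect_eq subsetI)
  qed auto
  then show ?thesis by (simp add: regular_pencil_def M_def ev flip: ev)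
qed

lemma det_pencil_neq_0_iff:
  fixes E A :: "'a::field^'k^'k"
  shows "det (map_matrix ((*) s) E - A) \<noteq> 0 \<longleftrightarrow> (\<forall>v. s *s (E *v v) = A *v v \<longrightarrow> v = 0)"
proof -
  have "(map_matrix ((*) s) E - A) *v v = s *s (E *v v) - A *v v" for v
    by (simp add: vec_eq_iff matrix_vector_mult_def left_diff_distrib sum_subtractf sum_distrib_left mult.assoc)
  then show ?thesis
    by (simp add: invertible_det_nz[symmetric] invertible_left_inverse matrix_left_invertible_ker)
qed

section \<open>Block vectors and the kernel of the optimality pencil\<close>

definition vec3 :: "'a^'k \<Rightarrow> 'a^'l \<Rightarrow> 'a^'m \<Rightarrow> 'a^('k::finite + 'l::finite + 'm::finite)"
  where "vec3 x y z = (\<chi> p. case p of Inl i \<Rightarrow> x $ i | Inr (Inl i) \<Rightarrow> y $ i | Inr (Inr i) \<Rightarrow> z $ i)"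

lemma vec3_nth [simp]:
  "vec3 x y z $ Inl i = x $ i" "vec3 x y z $ Inr (Inl j) = y $ j" "vec3 x y z $ Inr (Inr k) = z $ k"
  by (simp_all add: vec3_def)

lemma vec_eq_iff3:
  "v = w \<longleftrightarrow> (\<forall>i. v $ Inl i = w $ Inl i) \<and> (\<forall>i. v $ Inr (Inl i) = w $ Inr (Inl i)) \<and>
     (\<forall>i. v $ Inr (Inr i) = w $ Inr (Inr i))"
  by (metis (no_types) sumE vec_eq_iff)

lemma vec3_eq_iff [simp]: "vec3 x y z = vec3 x' y' z' \<longleftrightarrow> x = x' \<and> y = y' \<and> z = z'"
  by (simp add: vec_eq_iff3) (simp add: vec_eq_iff)

lemma vec3_eq_0_iff [simp]: "vec3 x y z = 0 \<longleftrightarrow> x = 0 \<and> y = 0 \<and> z = 0"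
  by (simp add: vec_eq_iff3) (simp add: vec_eq_iff)

lemma vec3_cases: obtains x y z where "v = vec3 x y z"
proof
  show "v = vec3 (\<chi> i. v $ Inl i) (\<chi> i. v $ Inr (Inl i)) (\<chi> i. v $ Inr (Inr i))"
    by (simp add: vec_eq_iff3)
qed

lemma scale_vec3: "c *s vec3 x y z = vec3 (c *s x) (c *s y) (c *s z)"
  by (simp add: vec_eq_iff3)

lemma block3_mult_vec3:
  fixes A11 :: "'a::comm_ring_1^'k^'k"
  shows "block3 A11 A12 A13 A21 A22 A23 A31 A32 A33 *v vec3 x y z =
    vec3 (A11 *v x + A12 *v y + A13 *v z) (A21 *v x + A22 *v y + A23 *v z)
         (A31 *v x + A32 *v y + A33 *v z)"
proof -
  have sum3: "(\<Sum>p\<in>UNIV. f p) = (\<Sum>i\<in>UNIV. f (Inl i)) + (\<Sum>i\<in>UNIV. f (Inr (Inl i))) + (\<Sum>i\<in>UNIV. f (Inr (Inr i)))"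
    for f :: "('k + 'b::finite + 'c::finite) \<Rightarrow> 'a"
    by (simp add: UNIV_Plus_UNIV[symmetric] sum.Plus add.assoc del: UNIV_Plus_UNIV)
  show ?thesis
    by (simp add: vec_eq_iff3 matrix_vector_mult_def sum3 block3_def)
qed

lemma matrix_vector_mult_uminus: "(- A) *v x = - (A *v (x::'a::ring_1^'n))"
  by (simp add: matrix_vector_mult_def vec_eq_iff sum_negf)

lemma mat_mult_vector: "mat c *v x = c *s (x::'a::semiring_1^'n)"
  by (simp add: matrix_vector_mult_def vec_eq_iff mat_def if_distrib[of "\<lambda>a. a * _"] cong: if_cong)

lemma opt_pencil_kernel_iff:
  "s *s (opt_E *v vec3 x y u) = opt_A J R Q B S *v vec3 x y u \<longleftrightarrow>
     s *s y = ((J - R) ** Q) *v y + B *v u \<and>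
     - (s *s x) = conj_transpose ((J - R) ** Q) *v x + (Q ** R ** Q) *v y \<and>
     conj_transpose B *v x + S *v u = 0"
  unfolding opt_E_def opt_A_def block3_mult_vec3 scale_vec3 vec3_eq_iff
  by (simp add: matrix_vector_mult_uminus)

section \<open>The Hermitian inner product\<close>

definition cinner :: "complex^'n \<Rightarrow> complex^'n \<Rightarrow> complex"
  where "cinner x y = (\<Sum>i\<in>UNIV. cnj (x $ i) * y $ i)"

lemma cinner_add_right: "cinner x (y + z) = cinner x y + cinner x z"
  and cinner_scale_left: "cinner (c *s x) y = cnj c * cinner x y"
  and cinner_scale_right: "cinner x (c *s y) = c * cinner x y"
  and cinner_minus_left: "cinner (- x) y = - cinner x y"
  by (simp_all add: cinner_def algebra_simps sum.distrib sum_negf sum_distrib_left)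

lemma cinner_diff_left: "cinner (x - y) z = cinner x z - cinner y z"
  and cinner_diff_right: "cinner x (y - z) = cinner x y - cinner x z"
  by (simp_all add: cinner_def algebra_simps sum_subtractf)

lemma cinner_commute: "cinner y x = cnj (cinner x y)"
  by (simp add: cinner_def mult.commute)

lemma cinner_adjoint:
  fixes A :: "complex^'n^'m"
  shows "cinner x (A *v y) = cinner (conj_transpose A *v x) y"
proof -
  have "cinner x (A *v y) = (\<Sum>i\<in>UNIV. \<Sum>j\<in>UNIV. cnj (x $ i) * (A $ i $ j * y $ j))"
    by (simp add: cinner_def matrix_vector_mult_def sum_distrib_left)
  also have "\<dots> = (\<Sum>j\<in>UNIV. \<Sum>i\<in>UNIV. cnj (x $ i) * (A $ i $ j * y $ j))"
    by (rule sum.swap)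
  also have "\<dots> = cinner (conj_transpose A *v x) y"
    by (simp add: cinner_def conj_transpose_def matrix_vector_mult_def sum_distrib_left sum_distrib_right mult_ac)
  finally show ?thesis .
qed

lemma cinner_self: "cinner x x = of_real (\<Sum>i\<in>UNIV. (cmod (x $ i))\<^sup>2)"
  unfolding cinner_def of_real_sum by (intro sum.cong refl) (simp add: complex_norm_square mult.commute del: of_real_power)

lemma cinner_self_eq_0_iff: "cinner x x = 0 \<longleftrightarrow> x = 0"
  unfolding cinner_self of_real_eq_0_iff by (simp add: sum_nonneg_eq_0_iff vec_eq_iff)

lemma pos_semidef_iff_cinner: "pos_semidef A \<longleftrightarrow> (\<forall>x. 0 \<le> cinner x (A *v x))"
  by (simp add: pos_semidef_def cinner_def)

text \<open>
  With \<open>z = A y\<close>, nonnegativity of the form at \<open>y - t z\<close> reads \<open>0 \<le> t\<^sup>2 \<langle>z, A z\<rangle> - 2 t \<langle>z, z\<rangle>\<close>.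
  For small \<open>t > 0\<close> the linear term dominates unless \<open>z = 0\<close>.
\<close>

lemma pos_semidef_cinner_eq_0:
  fixes A :: "complex^'n^'n"
  assumes herm: "A = conj_transpose A" and psd: "pos_semidef A" and zero: "cinner y (A *v y) = 0"
  shows "A *v y = 0"
proof -
  define z where "z = A *v y"
  define a b where "a = Re (cinner z z)" and "b = Re (cinner z (A *v z))"
  have nonneg: "0 \<le> Re (cinner x (A *v x))" for x
    using psd by (simp add: pos_semidef_iff_cinner less_eq_complex_def)
  have bound: "2 * t * a \<le> t\<^sup>2 * b" for t :: real
  proof -
    let ?c = "complex_of_real t"
    have "cinner y (A *v z) = cinner z z"
      unfolding cinner_adjoint herm[symmetric] z_def ..
    then have "cinner (y - ?c *s z) (A *v (y - ?c *s z)) =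
        of_real (t\<^sup>2) * cinner z (A *v z) - of_real (2 * t) * cinner z z"
      using zero
      by (simp add: matrix_vector_mult_diff_distrib vec.scale cinner_diff_left cinner_diff_right
          cinner_scale_left cinner_scale_right z_def[symmetric] power2_eq_square algebra_simps)
    then show ?thesis using nonneg[of "y - ?c *s z"] by (simp add: a_def b_def)
  qed
  have "a \<le> 0"
  proof (rule ccontr)
    assume "\<not> a \<le> 0"
    (* The bound forces 2 a \<le> t b; this t satisfies t b \<le> a, also when b = 0. *)
    define t where "t = a / (b + 1)"
    have b: "b \<ge> 0" using nonneg by (simp add: b_def)
    then have "t > 0" using \<open>\<not> a \<le> 0\<close> by (simp add: t_def)
    then have "2 * a \<le> t * b" using bound[of t] by (simp add: power2_eq_square)
    also have "\<dots> \<le> a" using b \<open>\<not> a \<le> 0\<close> by (simp add: t_def field_simps)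
    finally show False using \<open>\<not> a \<le> 0\<close> by simp
  qed
  moreover have "cinner z z = of_real a" "a \<ge> 0"
    unfolding a_def cinner_self by (simp_all add: sum_nonneg)
  ultimately have "cinner z z = 0" by simp
  then show ?thesis by (simp add: cinner_self_eq_0_iff z_def)
qed

section \<open>The kernel at a point of the imaginary axis\<close>

lemma conj_transpose_mult: "conj_transpose (A ** B) = conj_transpose B ** conj_transpose (A :: complex^'n^'m)"
  by (simp add: conj_transpose_def matrix_matrix_mult_def vec_eq_iff mult.commute)

lemma conj_transpose_diff: "conj_transpose (A - B) = conj_transpose A - conj_transpose (B :: complex^'n^'m)"
  by (simp add: conj_transpose_def vec_eq_iff)

text \<open>
  This handles the costate component of a kernel vector. The idea is to write an eigenvector \<open>x\<close> of
  \<open>Q (J + R)\<close> for \<open>s = \<i>\<omega>\<close> as \<open>x = Q y\<close> with \<open>(J + R) Q y = s y\<close>. Pairing the latter equation with \<open>x\<close>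
  gives \<open>\<langle>x, J x\<rangle> + \<langle>x, R x\<rangle> = s \<langle>Q y, y\<rangle>\<close>, in which only \<open>\<langle>x, R x\<rangle>\<close> is real, since \<open>J\<close> is skew-Hermitian
  and \<open>Q\<close> is Hermitian. So \<open>R x = 0\<close>, and then \<open>y\<close> itself lies in the kernel that \<open>inj\<close> excludes.
\<close>

lemma costate_eq_0_if_injective:
  fixes J R Q :: "complex^'n^'n"
  assumes J: "J = - conj_transpose J" and R: "R = conj_transpose R" "pos_semidef R"
    and Q: "Q = conj_transpose Q"
    and inj: "\<And>y. (R ** Q) *v y = 0 \<Longrightarrow> (J ** Q - mat (\<i> * complex_of_real \<omega>)) *v y = 0 \<Longrightarrow> y = 0"
    and x: "Q *v ((J + R) *v x) = (\<i> * complex_of_real \<omega>) *s x"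
  shows "x = 0"
proof -
  let ?s = "\<i> * complex_of_real \<omega>"
  obtain y where y: "x = Q *v y" "(J + R) *v x = ?s *s y"
  proof (cases "\<omega> = 0")
    case True
    (* At \<omega> = 0 every vector of ker Q is excluded by inj, so Q is invertible. *)
    have Qinj: "z = 0" if "Q *v z = 0" for z
      by (rule inj) (simp_all add: True that matrix_vector_mul_assoc[symmetric] matrix_vector_mult_diff_rdistrib)
    then obtain P where "Q ** P = mat 1"
      using matrix_left_invertible_ker[of Q] matrix_left_right_inverse by blast
    then have x': "x = Q *v (P *v x)" by (simp add: matrix_vector_mul_assoc)
    have "(J + R) *v x = 0" by (rule Qinj) (use x True in simp)
    then have "(J + R) *v x = ?s *s (P *v x)" using True by simp
    with x' show ?thesis by (rule that)
  next
    case False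
    then have s: "?s \<noteq> 0" by simp
    show ?thesis
    proof (rule that[of "inverse ?s *s ((J + R) *v x)"])
      show "x = Q *v (inverse ?s *s ((J + R) *v x))"
        by (simp only: vec.scale x vector_smult_assoc left_inverse[OF s] vector_smult_lid)
      show "(J + R) *v x = ?s *s (inverse ?s *s ((J + R) *v x))"
        by (simp only: vector_smult_assoc right_inverse[OF s] vector_smult_lid)
    qed
  qed
  have Jx: "Re (cinner x (J *v x)) = 0"
  proof -
    have "cinner x (J *v x) = cinner ((- J) *v x) x"
      unfolding cinner_adjoint[of x J] using J by (metis add.inverse_inverse)
    also have "\<dots> = - cnj (cinner x (J *v x))"
      by (simp add: matrix_vector_mult_uminus cinner_minus_left flip: cinner_commute)
    finally show ?thesis by (auto simp: complex_eq_iff)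
  qed
  have xy: "Im (cinner x y) = 0"
  proof -
    have "cinner x y = cinner y x"
      unfolding y(1) cinner_adjoint[of y] Q[symmetric] ..
    then show ?thesis using cinner_commute[of x y] by (auto simp: complex_eq_iff)
  qed
  have "cinner x (J *v x) + cinner x (R *v x) = ?s * cinner x y"
    using arg_cong[OF y(2), of "cinner x"]
    by (simp add: matrix_vector_mult_add_rdistrib cinner_add_right cinner_scale_right)
  then have "Re (cinner x (R *v x)) = 0"
    using Jx xy by (auto simp: complex_eq_iff)
  moreover have "Im (cinner x (R *v x)) = 0" 
    using R(2) by (auto simp: pos_semidef_iff_cinner less_eq_complex_def)
  ultimately have Rx: "R *v x = 0" 
    using R by (intro pos_semidef_cinner_eq_0[of R]) (auto simp: complex_eq_iff)
  have "y = 0"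
  proof (rule inj)
    show "(R ** Q) *v y = 0" using Rx y(1) by (simp add: matrix_vector_mul_assoc)
    have "J *v x = ?s *s y" using y(2) Rx by (simp add: matrix_vector_mult_add_rdistrib)
    then show "(J ** Q - mat ?s) *v y = 0"
      using y(1) by (simp add: matrix_vector_mult_diff_rdistrib matrix_vector_mul_assoc[symmetric] mat_mult_vector)
  qed
  then show ?thesis using y by simp
qed

text \<open>
  The energy identity. For a kernel vector \<open>(x, y, u)\<close> at \<open>s = \<i>\<omega>\<close>, pair the first block row with \<open>x\<close>
  and substitute the other two rows. The terms \<open>s \<langle>x, y\<rangle>\<close> cancel because \<open>s\<close> is purely imaginary,
  and \<open>\<langle>Q y, R Q y\<rangle> + \<langle>u, S u\<rangle> = 0\<close> remains. Both summands are nonnegative, so \<open>R Q y = 0\<close> and \<open>S u = 0\<close>,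
  and the first row decouples from \<open>x\<close> into \<open>B u + (J Q - s) y = 0\<close>.

  Conversely, a pair \<open>(u, y)\<close> of this kind yields the kernel vector \<open>(0, y, u)\<close>.
  If no such pair exists except zero, then \<open>y = 0\<close> and \<open>u = 0\<close>, so the second row reads
  \<open>Q (J + R) x = s x\<close>, and this forces \<open>x = 0\<close> as well.
\<close>

lemma opt_pencil_nonsingular_iff:
  fixes J R Q :: "complex^'n^'n" and B :: "complex^'m^'n" and S :: "complex^'m^'m"
  assumes sys: "(J, R, Q, B) \<in> Sigma_systems" and S: "S = conj_transpose S" "pos_semidef S"
  defines "s \<equiv> \<lambda>\<omega>. \<i> * complex_of_real \<omega>"
  shows "det (map_matrix ((*) (s \<omega>)) opt_E - opt_A J R Q B S) \<noteq> 0 \<longleftrightarrow>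
    (\<forall>u\<in>mat_ker S. \<forall>y\<in>mat_ker (R ** Q). B *v u + (J ** Q - mat (s \<omega>)) *v y = 0 \<longrightarrow> u = 0 \<and> y = 0)"
    (is "?L \<longleftrightarrow> ?R")
proof -
  have JRQ: "J = - conj_transpose J" "R = conj_transpose R" "pos_semidef R" "Q = conj_transpose Q"
    using sys by (auto simp: Sigma_systems_def)
  let ?A = "(J - R) ** Q"
  note mult = matrix_vector_mult_diff_rdistrib mat_mult_vector matrix_vector_mul_assoc[symmetric]
  show ?thesis
  proof
    assume ?L
    then have L: "v = 0" if "s \<omega> *s (opt_E *v v) = opt_A J R Q B S *v v" for v
      using that by (auto simp: det_pencil_neq_0_iff)
    show ?R
    proof (intro ballI impI)
      fix u y assume *: "u \<in> mat_ker S" "y \<in> mat_ker (R ** Q)" "B *v u + (J ** Q - mat (s \<omega>)) *v y = 0"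
      have "vec3 (0::complex^'n) y u = 0"
        by (rule L) (use * in \<open>simp add: opt_pencil_kernel_iff mat_ker_def mult algebra_simps\<close>)
      then show "u = 0 \<and> y = 0" by simp
    qed
  next
    assume R: ?R
    show ?L
      unfolding det_pencil_neq_0_iff
    proof (intro allI impI)
      fix v assume "s \<omega> *s (opt_E *v v) = opt_A J R Q B S *v v"
      moreover obtain x y u where v: "v = vec3 x y u" by (rule vec3_cases)
      ultimately have row1: "s \<omega> *s y = ?A *v y + B *v u"
        and row2: "- (s \<omega> *s x) = conj_transpose ?A *v x + (Q ** R ** Q) *v y"
        and row3: "conj_transpose B *v x + S *v u = 0"
        by (simp_all add: opt_pencil_kernel_iff)
      have "s \<omega> * cinner x y = cinner (conj_transpose ?A *v x) y + cinner (conj_transpose B *v x) u"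
        using arg_cong[OF row1, of "cinner x"]
        by (simp add: cinner_scale_right cinner_add_right cinner_adjoint)
      also have "conj_transpose ?A *v x = - (s \<omega> *s x) - (Q ** R ** Q) *v y"
        using row2 by (simp add: eq_diff_eq)
      also have "conj_transpose B *v x = - (S *v u)"
        using row3 by (simp add: eq_neg_iff_add_eq_0)
      finally have "- cinner ((Q ** R ** Q) *v y) y = cinner (S *v u) u"
        by (simp add: cinner_diff_left cinner_minus_left cinner_scale_left s_def)
      then have "cinner ((Q ** R ** Q) *v y) y + cinner (S *v u) u = 0"
        by (metis add.right_inverse)
      moreover have "cinner ((Q ** R ** Q) *v y) y = cinner (Q *v y) (R *v (Q *v y))"
        using JRQ by (metis cinner_adjoint matrix_vector_mul_assoc)
      moreover have "cinner (S *v u) u = cinner u (S *v u)"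
        using S(1) by (metis cinner_adjoint)
      moreover have "0 \<le> cinner (Q *v y) (R *v (Q *v y))" "0 \<le> cinner u (S *v u)"
        using JRQ(3) S(2) by (auto simp: pos_semidef_iff_cinner)
      ultimately have "cinner (Q *v y) (R *v (Q *v y)) = 0" "cinner u (S *v u) = 0"
        by (simp_all add: add_nonneg_eq_0_iff)
      then have RQy: "R *v (Q *v y) = 0" and Su: "S *v u = 0"
        using pos_semidef_cinner_eq_0[OF JRQ(2,3), of "Q *v y"] pos_semidef_cinner_eq_0[OF S, of u]
        by simp_all
      have "u \<in> mat_ker S" "y \<in> mat_ker (R ** Q)"
        using Su RQy by (simp_all add: mat_ker_def matrix_vector_mul_assoc[symmetric])
      moreover have "B *v u + (J ** Q - mat (s \<omega>)) *v y = 0"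
        using row1 RQy by (simp add: mult)
      ultimately have "u = 0 \<and> y = 0" by (rule R[rule_format])
      then have uy: "u = 0" "y = 0" by simp_all
      have "conj_transpose ?A = - (Q ** (J + R))"
      proof -
        have "conj_transpose J = - J" using JRQ(1) by (metis add.inverse_inverse)
        then have "conj_transpose ?A = Q ** (- J - R)"
          by (simp only: conj_transpose_mult conj_transpose_diff flip: JRQ(2,4))
        also have "\<dots> = - (Q ** (J + R))"
          by (simp add: matrix_matrix_mult_def vec_eq_iff algebra_simps flip: sum_negf)
        finally show ?thesis .
      qed
      then have x_eq: "Q *v ((J + R) *v x) = s \<omega> *s x"
        using row2 uy by (simp add: matrix_vector_mult_uminus matrix_vector_mul_assoc)
      have "z = 0" if "(R ** Q) *v z = 0" "(J ** Q - mat (s \<omega>)) *v z = 0" for z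
        using R[rule_format, of 0 z] that by (simp add: mat_ker_def)
      then have "x = 0"
        using x_eq unfolding s_def by (rule costate_eq_0_if_injective[OF JRQ])
      then show "v = 0" using v uy by simp
    qed
  qed
qed

lemma regular_opt_pencil_iff:
  fixes J R Q :: "complex^'n^'n" and B :: "complex^'m^'n" and S :: "complex^'m^'m"
  assumes sys: "(J, R, Q, B) \<in> Sigma_systems" and S: "S = conj_transpose S" "pos_semidef S"
  shows "regular_pencil opt_E (opt_A J R Q B S) \<longleftrightarrow>
    (\<exists>\<omega>::real. int (vec.dim (ker_image_sum J R Q B S \<omega>)) =
       int CARD('m) + int CARD('n) - (int (rank S) + int (rank (R ** Q))))"
proof -
  let ?s = "\<lambda>\<omega>. \<i> * complex_of_real \<omega>"
  have inf: "infinite (range ?s)"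
    by (simp add: finite_image_iff inj_on_def infinite_UNIV_char_0)
  have "int (vec.dim (ker_image_sum J R Q B S \<omega>)) =
       int CARD('m) + int CARD('n) - (int (rank S) + int (rank (R ** Q))) \<longleftrightarrow>
     vec.dim (ker_image_sum J R Q B S \<omega>) = vec.dim (mat_ker S) + vec.dim (mat_ker (R ** Q))" for \<omega>
    using vec_dim_mat_ker[of S] vec_dim_mat_ker[of "R ** Q"] by linarith
  then show ?thesis
    unfolding regular_pencil_iff_det_neq_0[OF inf] ker_image_sum_def
      vec_dim_sum_images_eq_iff[OF subspace_mat_ker subspace_mat_ker]
    by (simp add: opt_pencil_nonsingular_iff[OF sys S])
qed

section \<open>Complexification\<close>

lemma complexify_mult: "complexify (A ** B) = complexify A ** complexify B"
  by (simp add: matrix_matrix_mult_def vec_eq_iff)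

lemma complexify_diff: "complexify (A - B) = complexify A - complexify B"
  by (simp add: vec_eq_iff)

lemma conj_transpose_complexify: "conj_transpose (complexify A) = complexify (conj_transpose A)"
  by (simp add: conj_transpose_def vec_eq_iff)

lemma complexify_block3:
  "complexify (block3 A11 A12 A13 A21 A22 A23 A31 A32 A33) =
   block3 (complexify A11) (complexify A12) (complexify A13) (complexify A21) (complexify A22)
     (complexify A23) (complexify A31) (complexify A32) (complexify A33)"
  by (simp add: vec_eq_iff block3_def split: sum.splits)

lemma complexify_0: "complexify 0 = 0"
  and complexify_mat_1: "complexify (mat 1) = mat 1"
  and complexify_uminus: "complexify (- A) = - complexify A"
  by (simp_all add: vec_eq_iff mat_def)

lemma complexify_opt_E: "complexify opt_E = opt_E"
  by (simp only: opt_E_def complexify_block3 complexify_0 complexify_mat_1 complexify_uminus)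

lemma complexify_opt_A:
  "complexify (opt_A J R Q B S) =
   opt_A (complexify J) (complexify R) (complexify Q) (complexify B) (complexify S)"
  by (simp only: opt_A_def complexify_block3 complexify_0 complexify_mult complexify_diff
      flip: conj_transpose_complexify)

lemma regular_pencil_complexify:
  "regular_pencil (complexify E) (complexify A) \<longleftrightarrow> regular_pencil E A"
proof -
  have inf: "infinite (range complex_of_real)"
    by (simp add: finite_image_iff inj_on_def infinite_UNIV_char_0)
  have "map_matrix ((*) (complex_of_real s)) (complexify E) - complexify A =
      complexify (map_matrix ((*) s) E - A)" for s
    by (simp add: vec_eq_iff)
  then have "det (map_matrix ((*) (complex_of_real s)) (complexify E) - complexify A) =
      complex_of_real (det (map_matrix ((*) s) E - A))" for s
    by (simp add: det_map_matrix)
  then show ?thesis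
    unfolding regular_pencil_iff_det_neq_0[OF inf]
    by (simp add: regular_pencil_iff_det_neq_0[OF infinite_UNIV_char_0])
qed

text \<open>
  For \<open>z = a + \<i> b\<close> the form equals \<open>a\<^sup>T A a + b\<^sup>T A b + \<i> (a\<^sup>T A b - b\<^sup>T A a)\<close>. Symmetry is what
  removes the imaginary part.
\<close>

lemma pos_semidef_complexify:
  fixes A :: "real^'n^'n"
  assumes sym: "A = conj_transpose A" and psd: "pos_semidef A"
  shows "pos_semidef (complexify A)"
proof -
  have A_sym: "A $ i $ j = A $ j $ i" for i j
    using arg_cong[OF sym, of "\<lambda>M. M $ i $ j"] by (simp add: conj_transpose_def)
  have psd': "0 \<le> (\<Sum>i\<in>UNIV. \<Sum>j\<in>UNIV. x i * (A $ i $ j * x j))" for x :: "'n \<Rightarrow> real"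
    using psd[unfolded pos_semidef_def, rule_format, of "\<chi> i. x i"]
    by (simp add: matrix_vector_mult_def sum_distrib_left)
  show ?thesis
    unfolding pos_semidef_def
  proof
    fix z :: "complex^'n"
    define a b where "a i = Re (z $ i)" and "b i = Im (z $ i)" for i
    let ?q = "\<Sum>i\<in>UNIV. conjugate (z $ i) * (complexify A *v z) $ i"
    have q: "?q = (\<Sum>i\<in>UNIV. \<Sum>j\<in>UNIV. cnj (z $ i) * (complex_of_real (A $ i $ j) * z $ j))"
      by (simp add: matrix_vector_mult_def sum_distrib_left)
    have Re: "Re ?q = (\<Sum>i\<in>UNIV. \<Sum>j\<in>UNIV. a i * (A $ i $ j * a j)) + (\<Sum>i\<in>UNIV. \<Sum>j\<in>UNIV. b i * (A $ i $ j * b j))"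
      unfolding q by (simp add: a_def b_def sum.distrib)
    have "(\<Sum>i\<in>UNIV. \<Sum>j\<in>UNIV. b i * (A $ i $ j * a j)) = (\<Sum>i\<in>UNIV. \<Sum>j\<in>UNIV. a i * (A $ i $ j * b j))"
      by (subst sum.swap) (simp add: A_sym mult_ac)
    then have "Im ?q = 0"
      unfolding q by (simp add: a_def b_def sum_subtractf)
    then show "0 \<le> ?q"
      using psd'[of a] psd'[of b] Re by (simp add: less_eq_complex_def)
  qed
qed

text \<open>
  A real basis of the real row space is also a complex basis of the complex one: in a vanishing
  complex combination of real vectors, the real and the imaginary parts of the coefficients give
  two vanishing real combinations.
\<close>

lemma rank_complexify:
  fixes A :: "real^'n^'m"
  shows "rank (complexify A) = rank A"
proof -
  define c :: "real^'n \<Rightarrow> complex^'n" where "c x = (\<chi> i. complex_of_real (x $ i))" for x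
  have c_sum: "c (\<Sum>b\<in>X. r b *s b) = (\<Sum>b\<in>X. complex_of_real (r b) *s c b)" for X r
    by (simp add: c_def vec_eq_iff)
  obtain B where B: "B \<subseteq> rows A" "vec.independent B" "rows A \<subseteq> vec.span B" "card B = vec.dim (rows A)"
    using vec.basis_exists by blast
  have fin: "finite B" using B(2) by (rule vec.finiteI_independent)
  have inj: "inj_on c X" for X by (auto simp: inj_on_def c_def vec_eq_iff)
  have ind: "g v = 0" if g: "(\<Sum>b\<in>B. g b *s c b) = 0" "v \<in> B" for g v
  proof -
    have "(\<Sum>b\<in>B. Re (g b) *s b) = 0" "(\<Sum>b\<in>B. Im (g b) *s b) = 0"
      using arg_cong[OF g(1), of "\<lambda>x. Re (x $ i)" for i] arg_cong[OF g(1), of "\<lambda>x. Im (x $ i)" for i]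
      by (simp_all add: vec_eq_iff c_def)
    then have "Re (g v) = 0" "Im (g v) = 0"
      using vec.independentD[OF B(2) fin subset_refl _ g(2), of "\<lambda>b. Re (g b)"]
        vec.independentD[OF B(2) fin subset_refl _ g(2), of "\<lambda>b. Im (g b)"] by simp_all
    then show ?thesis by (simp add: complex_eq_iff)
  qed
  have "vec.dim (c ` rows A) = card (c ` B)"
  proof (rule vec.dim_unique[of "c ` B"])
    show "vec.independent (c ` B)"
    proof (rule vec.independent_if_scalars_zero)
      fix g v assume "(\<Sum>x\<in>c ` B. g x *s x) = 0" "v \<in> c ` B"
      then show "g v = 0" using ind[of "g \<circ> c"] by (auto simp: sum.reindex[OF inj])
    qed (use fin in simp)
    show "c ` rows A \<subseteq> vec.span (c ` B)"
    proof clarify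
      fix r assume "r \<in> rows A"
      then obtain t where "r = (\<Sum>b\<in>B. t b *s b)" using B(3) vec.span_finite[OF fin] by auto
      then have "c r = (\<Sum>b\<in>B. complex_of_real (t b) *s c b)" by (simp add: c_sum)
      also have "\<dots> \<in> vec.span (c ` B)" by (intro vec.span_sum vec.span_scale vec.span_base imageI)
      finally show "c r \<in> vec.span (c ` B)" .
    qed
  qed (use B(1) in auto)
  moreover have "rows (complexify A) = c ` rows A"
  proof -
    have "row i (complexify A) = c (row i A)" for i by (simp add: row_def c_def)
    then show ?thesis by (auto simp: rows_def)
  qed
  ultimately show ?thesis
    using B(4) by (simp add: row_rank_def_gen card_image[OF inj])
qed

section \<open>The rank criterion for regularity\<close>

theorem corollary3p6:
  shows
    "(\<forall>(J::complex^'n^'n) R Q (B::complex^'m^'n) S.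
        (J, R, Q, B) \<in> Sigma_systems \<longrightarrow> S = conj_transpose S \<longrightarrow> pos_semidef S \<longrightarrow>
        (regular_pencil opt_E (opt_A J R Q B S) \<longleftrightarrow>
         (\<exists>\<omega>::real.
            int (vec.dim (ker_image_sum J R Q B S \<omega>)) =
            int CARD('m) + int CARD('n) - (int (rank S) + int (rank (R ** Q)))))) \<and>
     (\<forall>(J::real^'n^'n) R Q (B::real^'m^'n) S.
        (J, R, Q, B) \<in> Sigma_systems \<longrightarrow> S = conj_transpose S \<longrightarrow> pos_semidef S \<longrightarrow>
        (regular_pencil opt_E (opt_A J R Q B S) \<longleftrightarrow>
         (\<exists>\<omega>::real.
            int (vec.dim (ker_image_sum (complexify J) (complexify R) (complexify Q)
                   (complexify B) (complexify S) \<omega>)) =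
            int CARD('m) + int CARD('n) - (int (rank S) + int (rank (R ** Q))))))"
proof (intro conjI allI impI)
  fix J R Q :: "complex^'n^'n" and B :: "complex^'m^'n" and S :: "complex^'m^'m"
  assume "(J, R, Q, B) \<in> Sigma_systems" "S = conj_transpose S" "pos_semidef S"
  then show "regular_pencil opt_E (opt_A J R Q B S) \<longleftrightarrow>
         (\<exists>\<omega>::real.
            int (vec.dim (ker_image_sum J R Q B S \<omega>)) =
            int CARD('m) + int CARD('n) - (int (rank S) + int (rank (R ** Q))))"
    by (rule regular_opt_pencil_iff)
next
  fix J R Q :: "real^'n^'n" and B :: "real^'m^'n" and S :: "real^'m^'m"
  assume sys: "(J, R, Q, B) \<in> Sigma_systems" and S: "S = conj_transpose S" "pos_semidef S"
  have "J = - conj_transpose J" using sys by (auto simp: Sigma_systems_def)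
  then have J: "conj_transpose J = - J" by (metis add.inverse_inverse)
  have "conj_transpose (complexify J) = complexify (conj_transpose J)"
    by (rule conj_transpose_complexify)
  also note J
  finally have "conj_transpose (complexify J) = - complexify J" by (simp add: complexify_uminus)
  then have "complexify J = - conj_transpose (complexify J)" by simp
  moreover have "complexify R = conj_transpose (complexify R)" "complexify Q = conj_transpose (complexify Q)"
    using sys by (simp_all add: Sigma_systems_def conj_transpose_complexify)
  moreover have "pos_semidef (complexify R)" "pos_semidef (complexify Q)"
    using sys by (auto simp: Sigma_systems_def intro: pos_semidef_complexify)
  ultimately have sys': "(complexify J, complexify R, complexify Q, complexify B) \<in> Sigma_systems"
    by (simp add: Sigma_systems_def)
  have S': "complexify S = conj_transpose (complexify S)" "pos_semidef (complexify S)"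
    using S by (simp_all add: conj_transpose_complexify pos_semidef_complexify)
  show "regular_pencil opt_E (opt_A J R Q B S) \<longleftrightarrow>
         (\<exists>\<omega>::real.
            int (vec.dim (ker_image_sum (complexify J) (complexify R) (complexify Q)
                   (complexify B) (complexify S) \<omega>)) =
            int CARD('m) + int CARD('n) - (int (rank S) + int (rank (R ** Q))))"
    using regular_opt_pencil_iff[OF sys' S']
    by (simp only: rank_complexify regular_pencil_complexify
        flip: complexify_opt_E complexify_opt_A complexify_mult)
qed

end
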